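(* Let $R$ be a ring. 1. The set $T_l(R)$ is the largest (with respect to inclusion) left denominator set of $R$ contained in the set ${}'\mathcal{C}^w_R$. 2. The set $T_l(R)$ is the largest (with respect to inclusion) left denominator set of $R$ contained in the set $\mathcal{C}^w_R$.
   Context: Rings are associative with $1$ and nonzero. A multiplicative subset $S$ of $R$ is a submonoid of $(R,\cdot)$ with $1\in S$, $0\notin S$. It is a left Ore set if $Sr\cap Rs\neq\emptyset$ for all $r\in R$, $s\in S$; then $\mathrm{ass}(S):=\{r\in R\mid sr=0 \text{ for some } s\in S\}$ is an ideal. A left Ore set $S$ is a left denominator set if $rs=0$ with $r\in R$, $s\in S$ implies $r\in\mathrm{ass}(S)$. $\mathrm{Den}_l(R)$ is the set of left denominator sets of $R$; for $S\in\mathrm{Den}_l(R)$, $S^{-1}R=\{s^{-1}r\mid s\in S,r\in R\}$ is the left localization. $\mathrm{max.Den}_l(R)$ is the (non-empty) set of elements of $\mathrm{Den}_l(R)$ maximal under inclusion. $\mathcal{L}^s_l(R):=\bigcap_{S\in \mathrm{max.Den}_l(R)}S$. $T_l(R)$ is the union of all $S\in\mathrm{Den}_l(R)$ with $S\subseteq\mathcal{L}^s_l(R)$; it is the largest left denominator set of $R$ contained in $\mathcal{L}^s_l(R)$. For a ring $A$, $\mathcal{C}_A$ is the set of regular elements (non-zero-divisors) of $A$ and ${}'\mathcal{C}_A:=\{c\in A\mid ac=0 \text{ with } a\in A \text{ implies } a=0\}$ is the set of left regular elements. Put $\mathcal{C}^w_R:=\{c\in R\mid \frac{c}{1}\in\mathcal{C}_{S^{-1}R}\text{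 for all }S\in\mathrm{max.Den}_l(R)\}$ and ${}'\mathcal{C}^w_R:=\{c\in R\mid \frac{c}{1}\in{}'\mathcal{C}_{S^{-1}R}\text{ for all }S\in\mathrm{max.Den}_l(R)\}$. *)

theory Defs
  imports "HOL-Algebra.Ring"
begin

section \<open>Left Ore sets and left denominator sets\<close>

definition multiplicative_subset :: "('a, 'm) ring_scheme \<Rightarrow> 'a set \<Rightarrow> bool" where
  "multiplicative_subset R S \<longleftrightarrow> submonoid S R \<and> \<zero>\<^bsub>R\<^esub> \<notin> S"

definition left_Ore_set :: "('a, 'm) ring_scheme \<Rightarrow> 'a set \<Rightarrow> bool" where
  "left_Ore_set R S \<longleftrightarrow> multiplicative_subset R S \<and>
     (\<forall>r\<in>carrier R. \<forall>s\<in>S.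
        {s' \<otimes>\<^bsub>R\<^esub> r |s'. s' \<in> S} \<inter> {r' \<otimes>\<^bsub>R\<^esub> s |r'. r' \<in> carrier R} \<noteq> {})"

definition ass :: "('a, 'm) ring_scheme \<Rightarrow> 'a set \<Rightarrow> 'a set" where
  "ass R S = {r \<in> carrier R. \<exists>s\<in>S. s \<otimes>\<^bsub>R\<^esub> r = \<zero>\<^bsub>R\<^esub>}"

definition Den_l :: "('a, 'm) ring_scheme \<Rightarrow> 'a set set" where
  "Den_l R = {S. left_Ore_set R S \<and>
     (\<forall>r\<in>carrier R. \<forall>s\<in>S. r \<otimes>\<^bsub>R\<^esub> s = \<zero>\<^bsub>R\<^esub> \<longrightarrow> r \<in> ass R S)}"

definition max_Den_l :: "('a, 'm) ring_scheme \<Rightarrow> 'a set set" where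
  "max_Den_l R = {S \<in> Den_l R. \<forall>S'\<in>Den_l R. S \<subseteq> S' \<longrightarrow> S' = S}"

text \<open>The family \<open>max_Den_l R\<close> is non-empty for every nonzero ring, so the intersection
  below is a subset of \<open>carrier R\<close>.\<close>

definition strong_localizable :: "('a, 'm) ring_scheme \<Rightarrow> 'a set" where
  "strong_localizable R = \<Inter> (max_Den_l R)"

definition T_l :: "('a, 'm) ring_scheme \<Rightarrow> 'a set" where
  "T_l R = \<Union> {S \<in> Den_l R. S \<subseteq> strong_localizable R}"


section \<open>Left localization\<close>

text \<open>A pair \<open>(s, r)\<close> in \<open>S \<times> carrier R\<close> stands for the left fraction \<open>s\<^sup>-\<^sup>1r\<close>. Two left
  fractions are equal iff they can be brought to a common denominator in \<open>S\<close>
  with equal numerators; the multipliers \<open>a\<close>, \<open>b\<close> range over the whole ring.\<close>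

definition left_frac_rel ::
    "('a, 'm) ring_scheme \<Rightarrow> 'a set \<Rightarrow> (('a \<times> 'a) \<times> ('a \<times> 'a)) set" where
  "left_frac_rel R S = {((s, r), (t, q)).
     s \<in> S \<and> r \<in> carrier R \<and> t \<in> S \<and> q \<in> carrier R \<and>
     (\<exists>a\<in>carrier R. \<exists>b\<in>carrier R.
        a \<otimes>\<^bsub>R\<^esub> s = b \<otimes>\<^bsub>R\<^esub> t \<and> a \<otimes>\<^bsub>R\<^esub> s \<in> S \<and> a \<otimes>\<^bsub>R\<^esub> r = b \<otimes>\<^bsub>R\<^esub> q)}"

definition left_frac :: "('a, 'm) ring_scheme \<Rightarrow> 'a set \<Rightarrow> 'a \<Rightarrow> 'a \<Rightarrow> ('a \<times> 'a) set" where
  "left_frac R S s r = left_frac_rel R S `` {(s, r)}"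

text \<open>The operations are unions over all choices of representatives and of Ore multipliers;
  for a left denominator set \<open>S\<close> all these choices give the same class.
  Product: \<open>(s\<^sup>-\<^sup>1r)(t\<^sup>-\<^sup>1q) = (us)\<^sup>-\<^sup>1(pq)\<close> whenever \<open>ur = pt\<close> with \<open>u\<close> in \<open>S\<close>.
  Sum: \<open>s\<^sup>-\<^sup>1r + t\<^sup>-\<^sup>1q = (as)\<^sup>-\<^sup>1(ar + bq)\<close> whenever \<open>as = bt\<close> is in \<open>S\<close>.\<close>

definition left_loc :: "('a, 'm) ring_scheme \<Rightarrow> 'a set \<Rightarrow> ('a \<times> 'a) set ring" where
  "left_loc R S = \<lparr>
     carrier = (S \<times> carrier R) // left_frac_rel R S,
     mult = (\<lambda>X Y. \<Union>(s, r)\<in>X. \<Union>(t, q)\<in>Y.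
       \<Union>(u, p)\<in>{(u, p). u \<in> S \<and> p \<in> carrier R \<and> u \<otimes>\<^bsub>R\<^esub> r = p \<otimes>\<^bsub>R\<^esub> t}.
         left_frac R S (u \<otimes>\<^bsub>R\<^esub> s) (p \<otimes>\<^bsub>R\<^esub> q)),
     one = left_frac R S \<one>\<^bsub>R\<^esub> \<one>\<^bsub>R\<^esub>,
     zero = left_frac R S \<one>\<^bsub>R\<^esub> \<zero>\<^bsub>R\<^esub>,
     add = (\<lambda>X Y. \<Union>(s, r)\<in>X. \<Union>(t, q)\<in>Y.
       \<Union>(a, b)\<in>{(a, b). a \<in> carrier R \<and> b \<in> carrier R \<and>
                          a \<otimes>\<^bsub>R\<^esub> s = b \<otimes>\<^bsub>R\<^esub> t \<and> a \<otimes>\<^bsub>R\<^esub> s \<in> S}.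
         left_frac R S (a \<otimes>\<^bsub>R\<^esub> s) (a \<otimes>\<^bsub>R\<^esub> r \<oplus>\<^bsub>R\<^esub> b \<otimes>\<^bsub>R\<^esub> q))\<rparr>"


section \<open>Regular elements\<close>

definition left_regular :: "('a, 'm) ring_scheme \<Rightarrow> 'a set" where
  "left_regular A = {c \<in> carrier A. \<forall>a\<in>carrier A. a \<otimes>\<^bsub>A\<^esub> c = \<zero>\<^bsub>A\<^esub> \<longrightarrow> a = \<zero>\<^bsub>A\<^esub>}"

definition regular :: "('a, 'm) ring_scheme \<Rightarrow> 'a set" where
  "regular A = {c \<in> carrier A. \<forall>a\<in>carrier A.
     (a \<otimes>\<^bsub>A\<^esub> c = \<zero>\<^bsub>A\<^esub> \<longrightarrow> a = \<zero>\<^bsub>A\<^esub>) \<and> (c \<otimes>\<^bsub>A\<^esub> a = \<zero>\<^bsub>A\<^esub> \<longrightarrow> a = \<zero>\<^bsub>A\<^esub>)}"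

definition weak_left_regular :: "('a, 'm) ring_scheme \<Rightarrow> 'a set" where
  "weak_left_regular R = {c \<in> carrier R.
     \<forall>S\<in>max_Den_l R. left_frac R S \<one>\<^bsub>R\<^esub> c \<in> left_regular (left_loc R S)}"

definition weak_regular :: "('a, 'm) ring_scheme \<Rightarrow> 'a set" where
  "weak_regular R = {c \<in> carrier R.
     \<forall>S\<in>max_Den_l R. left_frac R S \<one>\<^bsub>R\<^esub> c \<in> regular (left_loc R S)}"

definition is_largest :: "'a set \<Rightarrow> ('a set \<Rightarrow> bool) \<Rightarrow> bool" where
  "is_largest M P \<longleftrightarrow> P M \<and> (\<forall>N. P N \<longrightarrow> N \<subseteq> M)"

end

(* The submonoid generated by a family of left denominator sets is again a left denominator set as
   soon as it does not contain 0: the Ore condition and the denominator condition pass through a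
   product one factor at a time. If S is a maximal left denominator set and T is one whose elements
   become left regular in the localization at S, then r m in ass(S) implies r in ass(S) for every
   product m of elements of S and T; so S and T generate a left denominator set, and T is contained
   in S by maximality. Conversely, elements of S become units in the localization at S. *)

theory Submission
  imports Defs
begin

section \<open>Submonoids generated by left denominator sets\<close>

context ring
begin

text \<open>Words grow on the right because both conditions to be checked concern right
  multiplication by a denominator: in \<open>r \<otimes> (m \<otimes> t)\<close> the induction
  strips \<open>t\<close> first.\<close>

inductive_set monoid_span :: "'a set \<Rightarrow> 'a set" for A where
  one: "\<one> \<in> monoid_span A"
| step: "m \<in> monoid_span A \<Longrightarrow> t \<in> A \<Longrightarrow> m \<otimes> t \<in> monoid_span A"

lemma monoid_span_carrier:
  assumes "A \<subseteq> carrier R" and "m \<in> monoid_span A"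
  shows "m \<in> carrier R"
  using assms(2) by induction (use assms(1) in auto)

lemma subset_monoid_span:
  assumes "A \<subseteq> carrier R"
  shows "A \<subseteq> monoid_span A"
proof
  fix t assume t: "t \<in> A"
  have "\<one> \<otimes> t \<in> monoid_span A"
    using t by (intro monoid_span.intros)
  moreover have "\<one> \<otimes> t = t" using t assms by auto
  ultimately show "t \<in> monoid_span A" by simp
qed

lemma monoid_span_mult:
  assumes "A \<subseteq> carrier R" and "x \<in> monoid_span A" and "y \<in> monoid_span A"
  shows "x \<otimes> y \<in> monoid_span A"
  using assms(3)
proof induction
  case one
  then show ?case using assms monoid_span_carrier by simp
next
  case (step m t)
  have "x \<otimes> (m \<otimes> t) = (x \<otimes> m) \<otimes> t"
    using step assms monoid_span_carrier by (subst m_assoc) auto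
  then show ?case using step by (simp add: monoid_span.step)
qed

lemma monoid_span_submonoid:
  assumes "A \<subseteq> carrier R"
  shows "submonoid (monoid_span A) R"
  by (rule submonoid.intro)
    (use assms monoid_span_carrier monoid_span_mult monoid_span.one in auto)

lemma monoid_span_least:
  assumes "submonoid S R" and "A \<subseteq> S"
  shows "monoid_span A \<subseteq> S"
proof
  fix m assume "m \<in> monoid_span A"
  then show "m \<in> S"
    by induction
      (use assms submonoid.m_closed[OF assms(1)] submonoid.one_closed[OF assms(1)] in auto)
qed

section \<open>Elementary properties of left denominator sets, and the sets they generate\<close>

lemma Den_l_submonoid: "S \<in> Den_l R \<Longrightarrow> submonoid S R"
  by (simp add: Den_l_def left_Ore_set_def multiplicative_subset_def)

lemma Den_l_zero: "S \<in> Den_l R \<Longrightarrow> \<zero> \<notin> S"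
  by (simp add: Den_l_def left_Ore_set_def multiplicative_subset_def)

lemma Den_l_carrier: "S \<in> Den_l R \<Longrightarrow> S \<subseteq> carrier R"
  using Den_l_submonoid submonoid.subset by blast

lemma Den_l_one: "S \<in> Den_l R \<Longrightarrow> \<one> \<in> S"
  by (rule submonoid.one_closed[OF Den_l_submonoid])

lemma Den_l_mult: "S \<in> Den_l R \<Longrightarrow> x \<in> S \<Longrightarrow> y \<in> S \<Longrightarrow> x \<otimes> y \<in> S"
  by (rule submonoid.m_closed[OF Den_l_submonoid])

lemma Den_l_Ore:
  assumes "S \<in> Den_l R" and "r \<in> carrier R" and "s \<in> S"
  obtains u p where "u \<in> S" and "p \<in> carrier R" and "u \<otimes> r = p \<otimes> s"
proof -
  have "{s' \<otimes> r |s'. s' \<in> S} \<inter> {r' \<otimes> s |r'. r' \<in> carrier R} \<noteq> {}"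
    using assms by (simp add: Den_l_def left_Ore_set_def)
  then have "\<exists>u\<in>S. \<exists>p\<in>carrier R. u \<otimes> r = p \<otimes> s"
    by auto
  then show thesis by (elim bexE) (rule that)
qed

lemma Den_l_ass:
  assumes "S \<in> Den_l R" and "r \<in> carrier R" and "s \<in> S" and "r \<otimes> s = \<zero>"
  obtains u where "u \<in> S" and "u \<otimes> r = \<zero>"
proof -
  have "r \<in> ass R S"
    using assms by (auto simp: Den_l_def)
  then show thesis using that by (auto simp: ass_def)
qed

text \<open>Each factor of a word is handled by the member of \<open>F\<close> that contains it, and
  the multipliers supplied by different members multiply inside the span. For empty \<open>F\<close>
  the span is just the set of \<open>\<one>\<close>.\<close>

lemma monoid_span_Den_l:
  assumes F: "F \<subseteq> Den_l R" and zero: "\<zero> \<notin> monoid_span (\<Union>F)"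
  shows "monoid_span (\<Union>F) \<in> Den_l R"
proof -
  let ?M = "monoid_span (\<Union>F)"
  have A: "\<Union>F \<subseteq> carrier R"
    using F Den_l_carrier by blast
  note AM = subset_monoid_span[OF A] and Mcl = monoid_span_mult[OF A]
    and Mcar = monoid_span_carrier[OF A]
  have ore: "\<exists>u\<in>?M. \<exists>p\<in>carrier R. u \<otimes> r = p \<otimes> m" if "m \<in> ?M" "r \<in> carrier R" for r m
    using that
  \<comment> \<open>The induction hypothesis is needed for another element, the numerator
    \<open>p\<close> that the last factor \<open>t\<close> produces from \<open>r\<close>.\<close>
  proof (induction arbitrary: r)
    case one
    then show ?case using monoid_span.one by (metis l_one r_one)
  next
    case (step m t)
    then obtain T where T: "T \<in> F" "t \<in> T" "T \<in> Den_l R"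
      using F by blast
    obtain u p where up: "u \<in> T" "p \<in> carrier R" "u \<otimes> r = p \<otimes> t"
      using Den_l_Ore[OF T(3) step.prems T(2)] .
    obtain v q where vq: "v \<in> ?M" "q \<in> carrier R" "v \<otimes> p = q \<otimes> m"
      using step.IH up by blast
    have car: "u \<in> carrier R" "v \<in> carrier R" "t \<in> carrier R" "m \<in> carrier R"
      using up vq T step Mcar A by blast+
    have "(v \<otimes> u) \<otimes> r = (v \<otimes> p) \<otimes> t"
      using car up step.prems by (simp add: m_assoc)
    also have "\<dots> = q \<otimes> (m \<otimes> t)"
      using car vq by (simp add: m_assoc)
    finally show ?case
      using Mcl vq up T AM by blast
  qed
  have den: "\<exists>u\<in>?M. u \<otimes> r = \<zero>" if "m \<in> ?M" "r \<in> carrier R" "r \<otimes> m = \<zero>" for r m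
    using that
  proof (induction arbitrary: r)
    case one
    then show ?case using monoid_span.one by (metis l_one r_one)
  next
    case (step m t)
    then obtain T where T: "T \<in> F" "t \<in> T" "T \<in> Den_l R"
      using F by blast
    have car: "t \<in> carrier R" "m \<in> carrier R"
      using T step Mcar A by blast+
    \<comment> \<open>The denominator condition of \<open>T\<close> trades the right factor
      \<open>t\<close> for a left factor \<open>u\<close>; the induction hypothesis then applies to
      \<open>u \<otimes> r\<close>.\<close>
    have "(r \<otimes> m) \<otimes> t = \<zero>"
      using step.prems car by (simp add: m_assoc)
    then obtain u where u: "u \<in> T" "u \<otimes> (r \<otimes> m) = \<zero>"
      using Den_l_ass[OF T(3) _ T(2)] step.prems car by (metis m_closed)
    have uc: "u \<in> carrier R" using u T A by blast
    have "(u \<otimes> r) \<otimes> m = \<zero>"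
      using u uc car step.prems by (simp add: m_assoc)
    then obtain v where v: "v \<in> ?M" "v \<otimes> (u \<otimes> r) = \<zero>"
      using step.IH[of "u \<otimes> r"] uc step.prems by auto
    have "(v \<otimes> u) \<otimes> r = \<zero>"
      using v uc Mcar step.prems by (simp add: m_assoc)
    then show ?case
      using Mcl v u T AM by blast
  qed
  have "{s' \<otimes> r |s'. s' \<in> ?M} \<inter> {r' \<otimes> s |r'. r' \<in> carrier R} \<noteq> {}"
    if "r \<in> carrier R" "s \<in> ?M" for r s
    using ore[OF that(2,1)] by blast
  moreover have "r \<in> ass R ?M" if "r \<in> carrier R" "s \<in> ?M" "r \<otimes> s = \<zero>" for r s
    using den[OF that(2,1,3)] that(1) by (simp add: ass_def)
  ultimately show ?thesis
    using monoid_span_submonoid[OF A] zero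
    by (auto simp: Den_l_def left_Ore_set_def multiplicative_subset_def)
qed

section \<open>Existence of maximal left denominator sets\<close>

lemma exists_max_Den_l:
  assumes "\<one> \<noteq> \<zero>"
  shows "max_Den_l R \<noteq> {}"
proof -
  have "\<exists>S\<in>Den_l R. \<forall>X\<in>Den_l R. S \<subseteq> X \<longrightarrow> X = S"
  \<comment> \<open>The upper bound of a chain is the span of its union, which also serves the empty
    chain.\<close>
  proof (rule subset_Zorn)
    fix C assume C: "subset.chain (Den_l R) C"
    then have CD: "C \<subseteq> Den_l R"
      by (simp add: subset_chain_def)
    have A: "\<Union>C \<subseteq> carrier R"
      using CD Den_l_carrier by blast
    \<comment> \<open>Two members of a chain are comparable, so the span adds at most
      \<open>\<one>\<close> to the union and \<open>\<zero>\<close> stays outside.\<close>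
    have "m = \<one> \<or> m \<in> \<Union>C" if "m \<in> monoid_span (\<Union>C)" for m
      using that
    proof induction
      case (step m t)
      then obtain T where T: "T \<in> C" "t \<in> T" by blast
      show ?case
      proof (cases "m = \<one>")
        case True
        then show ?thesis using T A by auto
      next
        case False
        then obtain T' where T': "T' \<in> C" "m \<in> T'" using step by blast
        have "T \<subseteq> T' \<or> T' \<subseteq> T"
          using C T T' by (auto simp: subset_chain_def)
        then show ?thesis
          using Den_l_mult CD T T' by blast
      qed
    qed simp
    then have "\<zero> \<notin> monoid_span (\<Union>C)"
      using assms CD Den_l_zero by (metis UnionE subsetD)
    then have "monoid_span (\<Union>C) \<in> Den_l R"
      by (rule monoid_span_Den_l[OF CD])
    then show "\<exists>U\<in>Den_l R. \<forall>X\<in>C. X \<subseteq> U"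
      using subset_monoid_span[OF A] by blast
  qed
  then show ?thesis by (auto simp: max_Den_l_def)
qed

section \<open>The union \<open>T_l R\<close> is a left denominator set\<close>

lemma T_l_subset_max:
  assumes "S \<in> max_Den_l R"
  shows "T_l R \<subseteq> S"
  using assms by (auto simp: T_l_def strong_localizable_def)

text \<open>The span of the family defining \<open>T_l R\<close> stays inside every maximal left
  denominator set, so it belongs to the family itself and equals its union.\<close>

lemma T_l_Den_l:
  assumes "\<one> \<noteq> \<zero>"
  shows "T_l R \<in> Den_l R"
proof -
  define F where "F = {S \<in> Den_l R. S \<subseteq> strong_localizable R}"
  have TF: "T_l R = \<Union>F" by (simp add: T_l_def F_def)
  have sub: "monoid_span (\<Union>F) \<subseteq> S" if "S \<in> max_Den_l R" for S
  proof (rule monoid_span_least)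
    show "submonoid S R"
      using that Den_l_submonoid by (simp add: max_Den_l_def)
    show "\<Union>F \<subseteq> S"
      using T_l_subset_max[OF that] TF by simp
  qed
  have FD: "F \<subseteq> Den_l R" by (auto simp: F_def)
  \<comment> \<open>At least one maximal set exists; it contains the span and omits
    \<open>\<zero>\<close>.\<close>
  have "\<zero> \<notin> monoid_span (\<Union>F)"
    using exists_max_Den_l[OF assms] sub Den_l_zero by (auto simp: max_Den_l_def)
  then have "monoid_span (\<Union>F) \<in> Den_l R"
    by (rule monoid_span_Den_l[OF FD])
  moreover from this have "monoid_span (\<Union>F) \<in> F"
    using sub by (auto simp: F_def strong_localizable_def)
  moreover have "\<Union>F \<subseteq> monoid_span (\<Union>F)"
    using FD Den_l_carrier by (intro subset_monoid_span) blast
  ultimately show ?thesis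
    using TF by (metis Union_upper subset_antisym)
qed

section \<open>Cancellation modulo \<open>ass R S\<close>, and containment in a maximal set\<close>

lemma ass_cancel:
  assumes S: "S \<in> Den_l R" and "r \<in> carrier R" and "s \<in> S" and "r \<otimes> s \<in> ass R S"
  shows "r \<in> ass R S"
proof -
  note c = Den_l_carrier[OF S, THEN subsetD]
  obtain v where v: "v \<in> S" "v \<otimes> (r \<otimes> s) = \<zero>"
    using assms by (auto simp: ass_def)
  then have "(v \<otimes> r) \<otimes> s = \<zero>"
    using assms c by (simp add: m_assoc)
  then obtain w where w: "w \<in> S" "w \<otimes> (v \<otimes> r) = \<zero>"
    using Den_l_ass[OF S _ assms(3)] assms v c by (metis m_closed)
  have "(w \<otimes> v) \<otimes> r = \<zero>"
    using w v c assms by (simp add: m_assoc)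
  then show ?thesis
    using Den_l_mult[OF S w(1) v(1)] assms by (auto simp: ass_def)
qed

text \<open>The assumption \<open>reg\<close> is left regularity of the image of \<open>T\<close> in
  the localization at \<open>S\<close>, expressed inside \<open>R\<close>;
  \<open>left_frac_left_regular_iff\<close> provides the translation.\<close>

lemma Den_l_subset_max:
  assumes S: "S \<in> max_Den_l R" and T: "T \<in> Den_l R"
    and reg: "\<And>r t. r \<in> carrier R \<Longrightarrow> t \<in> T \<Longrightarrow> r \<otimes> t \<in> ass R S \<Longrightarrow> r \<in> ass R S"
  shows "T \<subseteq> S"
proof -
  have SD: "S \<in> Den_l R" using S by (simp add: max_Den_l_def)
  have A: "\<Union>{S, T} \<subseteq> carrier R"
    using SD T Den_l_carrier by blast
  let ?M = "monoid_span (\<Union>{S, T})"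
  have *: "r \<in> ass R S" if "m \<in> ?M" "r \<in> carrier R" "r \<otimes> m \<in> ass R S" for r m
    using that
  proof (induction arbitrary: r)
    case one
    then show ?case by simp
  next
    case (step m t)
    have car: "m \<in> carrier R" "t \<in> carrier R"
      using step A monoid_span_carrier[OF A] by blast+
    have "(r \<otimes> m) \<otimes> t \<in> ass R S"
      using step car by (simp add: m_assoc)
    moreover have "r \<otimes> m \<in> carrier R"
      using step.prems car by simp
    \<comment> \<open>The last factor is cancelled by \<open>ass_cancel\<close> if it lies in
      \<open>S\<close> and by \<open>reg\<close> if it lies in \<open>T\<close>.\<close>
    ultimately have "r \<otimes> m \<in> ass R S"
      using step.hyps ass_cancel[OF SD] reg by blast
    then show ?case using step by blast
  qed
  have "\<one> \<notin> ass R S"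
    using Den_l_zero[OF SD] Den_l_carrier[OF SD] by (auto simp: ass_def)
  moreover have "\<zero> \<in> ass R S"
    using Den_l_one[OF SD] by (auto simp: ass_def intro: bexI[of _ \<one>])
  \<comment> \<open>If \<open>\<zero>\<close> were a product, cancelling it from
    \<open>\<one> \<otimes> \<zero>\<close> would put \<open>\<one>\<close> into
    \<open>ass R S\<close>.\<close>
  ultimately have "\<zero> \<notin> ?M"
    using *[of \<zero> \<one>] by auto
  then have "?M \<in> Den_l R"
    using SD T by (intro monoid_span_Den_l) auto
  then have "?M = S"
    using S subset_monoid_span[OF A] by (auto simp: max_Den_l_def)
  then show ?thesis
    using subset_monoid_span[OF A] by auto
qed


section \<open>The left localization at a left denominator set\<close>

text \<open>This is the denominator condition applied to \<open>x \<ominus> y\<close>: a right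
  factor from \<open>S\<close> cancels at the cost of a left multiplier from
  \<open>S\<close>.\<close>

lemma Den_l_cancel:
  assumes S: "S \<in> Den_l R" and "x \<in> carrier R" and "y \<in> carrier R" and "s \<in> S"
    and "x \<otimes> s = y \<otimes> s"
  obtains u where "u \<in> S" and "u \<otimes> x = u \<otimes> y"
proof -
  note c = Den_l_carrier[OF S, THEN subsetD]
  have "(x \<ominus> y) \<otimes> s = \<zero>"
    using assms c by (simp add: minus_eq l_distr l_minus r_neg)
  then obtain u where u: "u \<in> S" "u \<otimes> (x \<ominus> y) = \<zero>"
    using Den_l_ass[OF S _ assms(4)] assms by (metis minus_closed)
  have "u \<otimes> x \<ominus> u \<otimes> y = \<zero>"
    using u c assms by (simp add: minus_eq r_distr r_minus)
  then have "u \<otimes> x = u \<otimes> y"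
    using u(1) c assms(2,3) by (metis m_closed a_inv_closed minus_eq minus_equality minus_minus)
  then show thesis using u that by blast
qed

text \<open>Equality of two fractions can be tested on any common multiple of the denominators, even
  one that does not lie in \<open>S\<close>.\<close>

lemma left_frac_rel_test:
  assumes S: "S \<in> Den_l R" and rel: "((s, r), (t, q)) \<in> left_frac_rel R S"
    and x: "x \<in> carrier R" and y: "y \<in> carrier R" and eq: "x \<otimes> s = y \<otimes> t"
  obtains u where "u \<in> S" and "u \<otimes> (x \<otimes> r) = u \<otimes> (y \<otimes> q)"
proof -
  note c = Den_l_carrier[OF S, THEN subsetD]
  obtain a b where ab: "a \<in> carrier R" "b \<in> carrier R" "a \<otimes> s = b \<otimes> t" "a \<otimes> s \<in> S"
      "a \<otimes> r = b \<otimes> q"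
    and mem: "s \<in> S" "r \<in> carrier R" "t \<in> S" "q \<in> carrier R"
    using rel by (auto simp: left_frac_rel_def)
  note car = ab(1,2) mem(2,4) c[OF mem(1)] c[OF mem(3)] x y
  \<comment> \<open>The Ore condition compares the given multiple \<open>x \<otimes> s\<close> with
    the common denominator \<open>a \<otimes> s\<close> that witnesses the relation. Cancelling
    \<open>s\<close> and \<open>t\<close> then relates \<open>x\<close> to \<open>a\<close> and
    \<open>y\<close> to \<open>b\<close>.\<close>
  obtain d e where de: "d \<in> S" "e \<in> carrier R" "d \<otimes> (x \<otimes> s) = e \<otimes> (a \<otimes> s)"
    using Den_l_Ore[OF S _ ab(4), of "x \<otimes> s"] car by auto
  have dc: "d \<in> carrier R" using de c by blast
  have "(d \<otimes> x) \<otimes> s = (e \<otimes> a) \<otimes> s"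
    using de dc car by (simp add: m_assoc)
  then obtain f where f: "f \<in> S" "f \<otimes> (d \<otimes> x) = f \<otimes> (e \<otimes> a)"
    using Den_l_cancel[OF S _ _ mem(1)] car de dc by (metis m_closed)
  have "(d \<otimes> y) \<otimes> t = (e \<otimes> b) \<otimes> t"
    using de dc car eq ab by (simp add: m_assoc)
  then obtain g where g: "g \<in> S" "g \<otimes> (d \<otimes> y) = g \<otimes> (e \<otimes> b)"
    using Den_l_cancel[OF S _ _ mem(3)] car de dc by (metis m_closed)
  have fc: "f \<in> carrier R" and gc: "g \<in> carrier R" using f g c by auto
  \<comment> \<open>The two cancellations cost different multipliers \<open>f\<close> and
    \<open>g\<close>; \<open>h \<otimes> f = k \<otimes> g\<close> lies in \<open>S\<close> and
    serves both.\<close>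
  obtain h k where hk: "h \<in> S" "k \<in> carrier R" "h \<otimes> f = k \<otimes> g"
    using Den_l_Ore[OF S fc g(1)] .
  have hc: "h \<in> carrier R" using hk c by blast
  have "(h \<otimes> f \<otimes> d) \<otimes> (x \<otimes> r) = h \<otimes> (f \<otimes> (d \<otimes> x)) \<otimes> r"
    using car fc gc hc dc by (simp add: m_assoc)
  also have "\<dots> = (h \<otimes> f) \<otimes> e \<otimes> (a \<otimes> r)"
    using car fc gc hc dc de(2) f by (simp add: m_assoc)
  also have "\<dots> = k \<otimes> (g \<otimes> (e \<otimes> b)) \<otimes> q"
    using car fc gc hc hk dc de(2) by (simp add: m_assoc ab(5))
  also have "\<dots> = (k \<otimes> g) \<otimes> d \<otimes> (y \<otimes> q)"
    using car fc gc hc hk(2) dc de(2) by (simp add: m_assoc flip: g(2))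
  also have "\<dots> = (h \<otimes> f \<otimes> d) \<otimes> (y \<otimes> q)"
    using hk by simp
  finally show thesis
    using that Den_l_mult[OF S] hk f de by blast
qed

lemma Den_l_common_multiple:
  assumes S: "S \<in> Den_l R" and "s \<in> S" and "t \<in> S"
  obtains x y where "x \<in> S" and "y \<in> carrier R" and "x \<otimes> s = y \<otimes> t" and "x \<otimes> s \<in> S"
  using Den_l_Ore[OF S _ assms(3), of s] Den_l_mult[OF S] Den_l_carrier[OF S] assms
  by (metis subsetD)

text \<open>The numerators need to agree only up to a left multiplier \<open>u\<close> in
  \<open>S\<close>, since \<open>u\<close> can be absorbed into \<open>x\<close> and
  \<open>y\<close> without the common denominator leaving \<open>S\<close>.\<close>

lemma left_frac_relI:
  assumes S: "S \<in> Den_l R" and mem: "s \<in> S" "r \<in> carrier R" "t \<in> S" "q \<in> carrier R"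
    and xy: "x \<in> carrier R" "y \<in> carrier R" "x \<otimes> s = y \<otimes> t" "x \<otimes> s \<in> S"
    and u: "u \<in> S" "u \<otimes> (x \<otimes> r) = u \<otimes> (y \<otimes> q)"
  shows "((s, r), (t, q)) \<in> left_frac_rel R S"
proof -
  note c = Den_l_carrier[OF S, THEN subsetD]
  note car = c[OF mem(1)] mem(2) c[OF mem(3)] mem(4) xy(1,2) c[OF u(1)]
  have "(u \<otimes> x) \<otimes> s = (u \<otimes> y) \<otimes> t" "(u \<otimes> x) \<otimes> r = (u \<otimes> y) \<otimes> q"
    using car xy u by (simp_all add: m_assoc)
  moreover have "(u \<otimes> x) \<otimes> s \<in> S"
    using car Den_l_mult[OF S u(1) xy(4)] by (simp add: m_assoc)
  ultimately show ?thesis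
    using mem car unfolding left_frac_rel_def by blast
qed

lemma left_frac_rel_equiv:
  assumes S: "S \<in> Den_l R"
  shows "equiv (S \<times> carrier R) (left_frac_rel R S)"
proof (rule equivI)
  note c = Den_l_carrier[OF S, THEN subsetD]
  show "left_frac_rel R S \<subseteq> (S \<times> carrier R) \<times> (S \<times> carrier R)"
    by (auto simp: left_frac_rel_def)
  show "refl_on (S \<times> carrier R) (left_frac_rel R S)"
    using c by (auto simp: refl_on_def left_frac_rel_def intro!: bexI[of _ \<one>])
  show "sym (left_frac_rel R S)"
    unfolding sym_def left_frac_rel_def by (clarsimp, metis)
  show "trans (left_frac_rel R S)"
  proof (rule transI)
    fix X Y Z
    assume XY: "(X, Y) \<in> left_frac_rel R S" and YZ: "(Y, Z) \<in> left_frac_rel R S"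
    obtain s r t q v w where [simp]: "X = (s, r)" "Y = (t, q)" "Z = (v, w)"
      by (metis surj_pair)
    have mem: "s \<in> S" "r \<in> carrier R" "t \<in> S" "q \<in> carrier R" "v \<in> S" "w \<in> carrier R"
      using XY YZ by (auto simp: left_frac_rel_def)
    obtain x y where xy: "x \<in> S" "y \<in> carrier R" "x \<otimes> s = y \<otimes> t" "x \<otimes> s \<in> S"
      using Den_l_common_multiple[OF S mem(1,3)] .
    \<comment> \<open>This yields a common multiple in \<open>S\<close> of all three denominators,
      on which both relations are compared.\<close>
    obtain a b where ab: "a \<in> S" "b \<in> carrier R" "a \<otimes> (x \<otimes> s) = b \<otimes> v"
        "a \<otimes> (x \<otimes> s) \<in> S"
      using Den_l_common_multiple[OF S xy(4) mem(5)] .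
    note car = c[OF mem(1)] mem(2) c[OF mem(3)] mem(4) c[OF mem(5)] mem(6) c[OF xy(1)] xy(2)
      c[OF ab(1)] ab(2)
    obtain g where g: "g \<in> S" "g \<otimes> (x \<otimes> r) = g \<otimes> (y \<otimes> q)"
      using left_frac_rel_test[OF S XY[simplified] _ _ xy(3)] car by metis
    \<comment> \<open>Agreement of \<open>x \<otimes> r\<close> and \<open>y \<otimes> q\<close> is
      known only after \<open>g\<close>. The Ore condition moves \<open>g\<close> past
      \<open>a\<close>, so it holds after \<open>d \<otimes> a\<close> too.\<close>
    obtain d e where de: "d \<in> S" "e \<in> carrier R" "d \<otimes> a = e \<otimes> g"
      using Den_l_Ore[OF S _ g(1), of a] car by auto
    have dc: "d \<in> carrier R" "g \<in> carrier R" using de g c by auto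
    have "(a \<otimes> y) \<otimes> t = b \<otimes> v"
      using ab car xy by (simp add: m_assoc)
    then obtain h where h: "h \<in> S" "h \<otimes> ((a \<otimes> y) \<otimes> q) = h \<otimes> (b \<otimes> w)"
      using left_frac_rel_test[OF S YZ[simplified]] car by (metis m_closed)
    have hc: "h \<in> carrier R" using h c by auto
    \<comment> \<open>\<open>k \<otimes> d = l \<otimes> h\<close> is a multiplier in
      \<open>S\<close> under which both comparisons hold.\<close>
    obtain k l where kl: "k \<in> S" "l \<in> carrier R" "k \<otimes> d = l \<otimes> h"
      using Den_l_Ore[OF S _ h(1), of d] dc by auto
    have kc: "k \<in> carrier R" using kl c by auto
    have "(k \<otimes> d) \<otimes> ((a \<otimes> x) \<otimes> r) = k \<otimes> (d \<otimes> a) \<otimes> (x \<otimes> r)"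
      using car dc kc by (simp add: m_assoc)
    also have "\<dots> = k \<otimes> e \<otimes> (g \<otimes> (x \<otimes> r))"
      using car dc kc de by (simp add: m_assoc)
    also have "\<dots> = k \<otimes> (e \<otimes> g) \<otimes> (y \<otimes> q)"
      using car dc kc de(2) g by (simp add: m_assoc)
    also have "\<dots> = (k \<otimes> d) \<otimes> ((a \<otimes> y) \<otimes> q)"
      using car dc kc by (simp add: m_assoc flip: de(3))
    also have "\<dots> = l \<otimes> (h \<otimes> ((a \<otimes> y) \<otimes> q))"
      using car dc kc kl hc by (simp add: m_assoc)
    also have "\<dots> = (l \<otimes> h) \<otimes> (b \<otimes> w)"
      using h hc car kl by (simp add: m_assoc)
    also have "\<dots> = (k \<otimes> d) \<otimes> (b \<otimes> w)"
      using kl by simp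
    finally have "(k \<otimes> d) \<otimes> ((a \<otimes> x) \<otimes> r) = (k \<otimes> d) \<otimes> (b \<otimes> w)" .
    moreover have "(a \<otimes> x) \<otimes> s = b \<otimes> v" "(a \<otimes> x) \<otimes> s \<in> S"
      using ab car by (simp_all add: m_assoc)
    ultimately show "(X, Z) \<in> left_frac_rel R S"
      using car mem Den_l_mult[OF S kl(1) de(1)]
      by (auto intro!: left_frac_relI[OF S, of _ _ _ _ "a \<otimes> x" b "k \<otimes> d"])
  qed
qed

section \<open>Products of fractions\<close>

lemma left_frac_rel_mult:
  assumes S: "S \<in> Den_l R"
    and 1: "((s, r), (s', r')) \<in> left_frac_rel R S"
    and 2: "((t, q), (t', q')) \<in> left_frac_rel R S"
    and up: "u \<in> S" "p \<in> carrier R" "u \<otimes> r = p \<otimes> t"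
    and up': "u' \<in> S" "p' \<in> carrier R" "u' \<otimes> r' = p' \<otimes> t'"
  shows "((u \<otimes> s, p \<otimes> q), (u' \<otimes> s', p' \<otimes> q')) \<in> left_frac_rel R S"
proof -
  note c = Den_l_carrier[OF S, THEN subsetD]
  have mem: "s \<in> S" "r \<in> carrier R" "s' \<in> S" "r' \<in> carrier R"
    "t \<in> S" "q \<in> carrier R" "t' \<in> S" "q' \<in> carrier R"
    using 1 2 by (auto simp: left_frac_rel_def)
  have us: "u \<otimes> s \<in> S" "u' \<otimes> s' \<in> S"
    using Den_l_mult[OF S] mem up up' by auto
  obtain x y where xy: "x \<in> S" "y \<in> carrier R" "x \<otimes> (u \<otimes> s) = y \<otimes> (u' \<otimes> s')"
      "x \<otimes> (u \<otimes> s) \<in> S"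
    using Den_l_common_multiple[OF S us] .
  note car = c[OF mem(1)] mem(2) c[OF mem(3)] mem(4) c[OF mem(5)] mem(6) c[OF mem(7)] mem(8)
    c[OF up(1)] up(2) c[OF up'(1)] up'(2) c[OF xy(1)] xy(2)
  have "(x \<otimes> u) \<otimes> s = (y \<otimes> u') \<otimes> s'"
    using xy car by (simp add: m_assoc)
  then obtain g where g: "g \<in> S" "g \<otimes> ((x \<otimes> u) \<otimes> r) = g \<otimes> ((y \<otimes> u') \<otimes> r')"
    using left_frac_rel_test[OF S 1] car by (metis m_closed)
  have gc: "g \<in> carrier R" using g c by auto
  \<comment> \<open>The Ore equations turn the comparison of \<open>r\<close> with \<open>r'\<close>
    into a common multiple of \<open>t\<close> and \<open>t'\<close>. It may lie outside
    \<open>S\<close>, which is why \<open>left_frac_rel_test\<close> admits arbitrary common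
    multiples.\<close>
  have "(g \<otimes> x \<otimes> p) \<otimes> t = (g \<otimes> y \<otimes> p') \<otimes> t'"
    using g gc car up up' by (simp add: m_assoc)
  then obtain h where h: "h \<in> S"
      "h \<otimes> ((g \<otimes> x \<otimes> p) \<otimes> q) = h \<otimes> ((g \<otimes> y \<otimes> p') \<otimes> q')"
    using left_frac_rel_test[OF S 2] car gc by (metis m_closed)
  have hc: "h \<in> carrier R" using h c by auto
  have "(h \<otimes> g) \<otimes> (x \<otimes> (p \<otimes> q)) = (h \<otimes> g) \<otimes> (y \<otimes> (p' \<otimes> q'))"
    using h hc gc car by (simp add: m_assoc)
  then show ?thesis
    using car us xy Den_l_mult[OF S h(1) g(1)]
    by (intro left_frac_relI[OF S, of _ _ _ _ x y "h \<otimes> g"]) auto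
qed

lemma left_frac_eq_iff:
  assumes S: "S \<in> Den_l R" and "s \<in> S" "r \<in> carrier R" "t \<in> S" "q \<in> carrier R"
  shows "left_frac R S s r = left_frac R S t q \<longleftrightarrow> ((s, r), (t, q)) \<in> left_frac_rel R S"
  unfolding left_frac_def
  using eq_equiv_class_iff[OF left_frac_rel_equiv[OF S]] assms by auto

text \<open>All classes in the union defining the product coincide by
  \<open>left_frac_rel_mult\<close>, and the given \<open>u\<close> and \<open>p\<close> show that
  the union is not empty.\<close>

lemma left_frac_mult:
  assumes S: "S \<in> Den_l R" and mem: "s \<in> S" "r \<in> carrier R" "t \<in> S" "q \<in> carrier R"
    and up: "u \<in> S" "p \<in> carrier R" "u \<otimes> r = p \<otimes> t"
  shows "left_frac R S s r \<otimes>\<^bsub>left_loc R S\<^esub> left_frac R S t q =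
    left_frac R S (u \<otimes> s) (p \<otimes> q)" (is "_ = ?Z")
proof -
  have same: "left_frac R S (u' \<otimes> s') (p' \<otimes> q') = ?Z"
    if "(s', r') \<in> left_frac R S s r" "(t', q') \<in> left_frac R S t q"
      "u' \<in> S" "p' \<in> carrier R" "u' \<otimes> r' = p' \<otimes> t'" for s' r' t' q' u' p'
    unfolding left_frac_def
    using left_frac_rel_mult[OF S _ _ up that(3-5)] that(1,2)
    by (intro equiv_class_eq[OF left_frac_rel_equiv[OF S], symmetric]) (auto simp: left_frac_def)
  have self: "(s, r) \<in> left_frac R S s r" "(t, q) \<in> left_frac R S t q"
    using equiv_class_self[OF left_frac_rel_equiv[OF S]] mem by (auto simp: left_frac_def)
  show ?thesis
  proof
    show "left_frac R S s r \<otimes>\<^bsub>left_loc R S\<^esub> left_frac R S t q \<subseteq> ?Z"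
      unfolding left_loc_def using same by fastforce
    show "?Z \<subseteq> left_frac R S s r \<otimes>\<^bsub>left_loc R S\<^esub> left_frac R S t q"
      unfolding left_loc_def using self up by fastforce
  qed
qed

section \<open>Zero fractions and regular fractions\<close>

lemma left_frac_eq_zero_iff:
  assumes S: "S \<in> Den_l R" and s: "s \<in> S" and r: "r \<in> carrier R"
  shows "left_frac R S s r = \<zero>\<^bsub>left_loc R S\<^esub> \<longleftrightarrow> r \<in> ass R S"
proof -
  note c = Den_l_carrier[OF S, THEN subsetD]
  have sc: "s \<in> carrier R" using s c by auto
  have "((s, r), (\<one>, \<zero>)) \<in> left_frac_rel R S \<longleftrightarrow> r \<in> ass R S"
  proof
    assume "((s, r), (\<one>, \<zero>)) \<in> left_frac_rel R S"
    then obtain u where "u \<in> S" "u \<otimes> (\<one> \<otimes> r) = u \<otimes> (s \<otimes> \<zero>)"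
      \<comment> \<open>The denominators \<open>s\<close> and \<open>\<one>\<close> have the common
        multiple \<open>\<one> \<otimes> s = s \<otimes> \<one>\<close>, on which the numerators
        become \<open>r\<close> and \<open>\<zero>\<close>.\<close>
      by (rule left_frac_rel_test[OF S, where x = \<one> and y = s]) (use sc in auto)
    then show "r \<in> ass R S"
      using c sc r by (auto simp: ass_def)
  next
    assume "r \<in> ass R S"
    then obtain u where "u \<in> S" "u \<otimes> r = \<zero>" by (auto simp: ass_def)
    then show "((s, r), (\<one>, \<zero>)) \<in> left_frac_rel R S"
      using c sc s r Den_l_one[OF S]
      by (intro left_frac_relI[OF S, of _ _ _ _ \<one> s u]) auto
  qed
  then show ?thesis
    using left_frac_eq_iff[OF S s r Den_l_one[OF S] zero_closed] by (simp add: left_loc_def)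
qed

lemma left_frac_carrier:
  assumes "s \<in> S" and "r \<in> carrier R"
  shows "left_frac R S s r \<in> carrier (left_loc R S)"
  using assms by (auto simp: left_loc_def left_frac_def intro: quotientI)

lemma left_loc_cases:
  assumes "X \<in> carrier (left_loc R S)"
  obtains s r where "s \<in> S" and "r \<in> carrier R" and "X = left_frac R S s r"
  using assms by (auto simp: left_loc_def left_frac_def elim!: quotientE)

lemma left_frac_mult_one:
  assumes S: "S \<in> Den_l R" and "s \<in> S" "r \<in> carrier R" "c \<in> carrier R"
  shows "left_frac R S s r \<otimes>\<^bsub>left_loc R S\<^esub> left_frac R S \<one> c = left_frac R S s (r \<otimes> c)"
  using left_frac_mult[OF S assms(2,3) Den_l_one[OF S] assms(4) Den_l_one[OF S] assms(3)]
    assms Den_l_carrier[OF S] by auto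

text \<open>Right multiplication by the image of \<open>c\<close> changes only the numerator, and
  whether a fraction vanishes depends only on its numerator, so all denominators drop out.\<close>

lemma left_frac_left_regular_iff:
  assumes S: "S \<in> Den_l R" and c: "c \<in> carrier R"
  shows "left_frac R S \<one> c \<in> left_regular (left_loc R S) \<longleftrightarrow>
    (\<forall>r\<in>carrier R. r \<otimes> c \<in> ass R S \<longrightarrow> r \<in> ass R S)"
    (is "?L \<longleftrightarrow> ?R")
proof
  assume L: ?L
  show ?R
  proof (intro ballI impI)
    fix r assume r: "r \<in> carrier R" and "r \<otimes> c \<in> ass R S"
    then have "left_frac R S \<one> r \<otimes>\<^bsub>left_loc R S\<^esub> left_frac R S \<one> c = \<zero>\<^bsub>left_loc R S\<^esub>"
      using c Den_l_one[OF S] by (simp add: left_frac_mult_one[OF S] left_frac_eq_zero_iff[OF S])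
    then have "left_frac R S \<one> r = \<zero>\<^bsub>left_loc R S\<^esub>"
      using L left_frac_carrier[OF Den_l_one[OF S] r] by (auto simp: left_regular_def)
    then show "r \<in> ass R S"
      using left_frac_eq_zero_iff[OF S Den_l_one[OF S] r] by simp
  qed
next
  assume R: ?R
  have "X = \<zero>\<^bsub>left_loc R S\<^esub>"
    if X: "X \<in> carrier (left_loc R S)"
      and 0: "X \<otimes>\<^bsub>left_loc R S\<^esub> left_frac R S \<one> c = \<zero>\<^bsub>left_loc R S\<^esub>" for X
  proof -
    obtain s r where sr: "s \<in> S" "r \<in> carrier R" "X = left_frac R S s r"
      using left_loc_cases[OF X] .
    then show ?thesis
      using 0 R c by (simp add: left_frac_mult_one[OF S] left_frac_eq_zero_iff[OF S])
  qed
  then show ?L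
    using left_frac_carrier[OF Den_l_one[OF S] c] by (auto simp: left_regular_def)
qed

text \<open>Elements of \<open>S\<close> become units, but both cancellation properties can be
  checked without forming an inverse: \<open>ass_cancel\<close> gives the left one, and expanding a
  fraction by an Ore multiplier gives the right one.\<close>

lemma left_frac_regular:
  assumes S: "S \<in> Den_l R" and c: "c \<in> S"
  shows "left_frac R S \<one> c \<in> regular (left_loc R S)"
proof -
  note car = Den_l_carrier[OF S, THEN subsetD]
  have "left_frac R S \<one> c \<in> left_regular (left_loc R S)"
    using left_frac_left_regular_iff[OF S car[OF c]] ass_cancel[OF S _ c] by blast
  moreover have "X = \<zero>\<^bsub>left_loc R S\<^esub>"
    if X: "X \<in> carrier (left_loc R S)"
      and 0: "left_frac R S \<one> c \<otimes>\<^bsub>left_loc R S\<^esub> X = \<zero>\<^bsub>left_loc R S\<^esub>" for X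
  proof -
    obtain s r where sr: "s \<in> S" "r \<in> carrier R" "X = left_frac R S s r"
      using left_loc_cases[OF X] .
    obtain u p where up: "u \<in> S" "p \<in> carrier R" "u \<otimes> c = p \<otimes> s"
      using Den_l_Ore[OF S car[OF c] sr(1)] .
    have "left_frac R S (u \<otimes> \<one>) (p \<otimes> r) = \<zero>\<^bsub>left_loc R S\<^esub>"
      using 0 left_frac_mult[OF S Den_l_one[OF S] car[OF c] sr(1,2) up] sr by simp
    then have "p \<otimes> r \<in> ass R S"
      using left_frac_eq_zero_iff[OF S, of u "p \<otimes> r"] up sr car by simp
    then obtain v where v: "v \<in> S" "v \<otimes> (p \<otimes> r) = \<zero>"
      by (auto simp: ass_def)
    \<comment> \<open>Although \<open>p\<close> need not lie in \<open>S\<close>,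
      \<open>p \<otimes> s = u \<otimes> c\<close> does, so expanding the fraction of
      \<open>s\<close> and \<open>r\<close> by \<open>p\<close> is legitimate and exposes the
      numerator \<open>p \<otimes> r\<close> killed by \<open>v\<close>.\<close>
    have "p \<otimes> s \<in> S"
      using Den_l_mult[OF S up(1) c] up by simp
    then have "((s, r), (s, \<zero>)) \<in> left_frac_rel R S"
      using v sr up car by (intro left_frac_relI[OF S, of _ _ _ _ p p v]) auto
    then obtain w where "w \<in> S" "w \<otimes> (\<one> \<otimes> r) = w \<otimes> (\<one> \<otimes> \<zero>)"
      by (rule left_frac_rel_test[OF S, where x = \<one> and y = \<one>]) auto
    then have "r \<in> ass R S"
      using sr car by (auto simp: ass_def)
    then show ?thesis
      using left_frac_eq_zero_iff[OF S] sr by simp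
  qed
  ultimately show ?thesis
    by (auto simp: left_regular_def regular_def)
qed

section \<open>Weakly regular elements and \<open>T_l R\<close>\<close>

lemma weak_regular_subset: "weak_regular R \<subseteq> weak_left_regular R"
  by (auto simp: weak_regular_def weak_left_regular_def regular_def left_regular_def)

lemma T_l_subset_weak_regular:
  assumes "\<one> \<noteq> \<zero>"
  shows "T_l R \<subseteq> weak_regular R"
proof
  fix c assume c: "c \<in> T_l R"
  have "left_frac R S \<one> c \<in> regular (left_loc R S)" if "S \<in> max_Den_l R" for S
    using that c T_l_subset_max[OF that] left_frac_regular by (auto simp: max_Den_l_def)
  then show "c \<in> weak_regular R"
    using c Den_l_carrier[OF T_l_Den_l[OF assms]] by (auto simp: weak_regular_def)
qed

text \<open>By \<open>Den_l_subset_max\<close>, \<open>T\<close> lies in every maximal left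
  denominator set, hence is one of the sets whose union is \<open>T_l R\<close>.\<close>

lemma Den_l_weak_left_regular_subset_T_l:
  assumes T: "T \<in> Den_l R" and reg: "T \<subseteq> weak_left_regular R"
  shows "T \<subseteq> T_l R"
proof -
  have "T \<subseteq> S" if S: "S \<in> max_Den_l R" for S
  proof (rule Den_l_subset_max[OF S T])
    fix r t
    assume "r \<in> carrier R" "t \<in> T" "r \<otimes> t \<in> ass R S"
    moreover have "S \<in> Den_l R" using S by (simp add: max_Den_l_def)
    ultimately show "r \<in> ass R S"
      using left_frac_left_regular_iff reg S by (fastforce simp: weak_left_regular_def)
  qed
  then show ?thesis
    using T by (auto simp: T_l_def strong_localizable_def)
qed

end

theorem proposition2p15:
  fixes R :: "('a, 'm) ring_scheme"
  assumes "ring R" and "\<one>\<^bsub>R\<^esub> \<noteq> \<zero>\<^bsub>R\<^esub>"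
  shows "is_largest (T_l R) (\<lambda>T. T \<in> Den_l R \<and> T \<subseteq> weak_left_regular R) \<and>
         is_largest (T_l R) (\<lambda>T. T \<in> Den_l R \<and> T \<subseteq> weak_regular R)"
proof -
  interpret ring R by fact
  show ?thesis
    \<comment> \<open>Containment is proved for the smaller set \<open>weak_regular R\<close> and
      maximality for the larger set \<open>weak_left_regular R\<close>; the inclusion between them
      transfers each to the other claim.\<close>
    unfolding is_largest_def
    using T_l_Den_l[OF assms(2)] T_l_subset_weak_regular[OF assms(2)] weak_regular_subset
      Den_l_weak_left_regular_subset_T_l
    by blast
qed

end
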